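(* Let $\mathcal{M}\subseteq\mathcal{V}$, $u\in\mathcal{V}$, and let $u_{\mathcal{M}}\in\arg\min_{v\in\mathcal{M}}\|u-v\|$. Let $r>0$ and let $\mathcal{N}\subseteq\mathcal{M}\cap B(u_{\mathcal{M}},r)$ be a manifold containing $u_{\mathcal{M}}$ with $R := \operatorname{rch}(\mathcal{N},u_{\mathcal{M}})\ge r$. Then, pointwise on $Y$, $$\mathfrak{K}_{\{u_{\mathcal{M}}\}-\mathcal{N}} \le \left(\sqrt{\mathfrak{K}_{\mathbb{T}_{u_{\mathcal{M}}}\mathcal{N}}} + \frac{r}{2R}\sqrt{\mathfrak{K}_{\mathbb{T}^\perp_{u_{\mathcal{M}}}\mathcal{N}}}\right)^2 .$$
   Context: Let $\rho$ be a probability measure on a set $Y$ and $\|\cdot\| := \|\cdot\|_{L^2(Y,\rho)}$. Let $w$ be a weight function on $Y$, i.e. $w>0$ almost everywhere and $\int_Y w^{-1}\,\mathrm{d}\rho=1$. Define $$\mathcal{V} := \mathcal{V}_{w,\infty} := \{v\in L^\infty(Y,\rho) : \|v\|_{w,\infty}<\infty\},\qquad \|v\|_{w,\infty} := \operatorname{ess\,sup}_{y\in Y}\sqrt{w(y)}\,|v(y)|.$$ Functions are assumed to have point evaluations $v(y)$ at all $y\in Y$. The variation function of a set $A\subseteq\mathcal{V}$ is $$\mathfrak{K}_A(y) := \sup_{a\in U(A)}|a(y)|^2,\qquad U(A) := \{a/\|a\| : a\in A\setminus\{0\}\}$$ (the supremum over the empty set being $0$). $B(v,r)$ is the open ball of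 radius $r$ around $v$ with respect to $\|\cdot\|$. A manifold $\mathcal{N}\subseteq\mathcal{V}$ is a $\mathcal{C}^1$ submanifold of Euclidean space, i.e. of a finite-dimensional linear subspace of $\mathcal{V}$ equipped with the $L^2(Y,\rho)$ inner product; $\mathbb{T}_x\mathcal{N}$ is its tangent space at $x$ (a linear subspace) and $\mathbb{T}_x^\perp\mathcal{N}$ is the orthogonal complement of $\mathbb{T}_x\mathcal{N}$ in the linear span $\langle\mathcal{N}\rangle$. Local reach: for $A\subseteq\mathcal{V}$ let $P_A v := \arg\min_{a\in A}\|v-a\|$ and let $\operatorname{dom}(P_A)$ be the set of $v\in\mathcal{V}$ for which this minimiser exists and is unique. For $v\in A$, $\operatorname{rch}(A,v) := \sup\{r\ge0 : B(v,r)\subseteq\operatorname{dom}(P_A)\}\in[0,\infty]$. If $R=\infty$, then $r/(2R)$ is read as $0$. *)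

theory Defs
  imports "HOL-Probability.Essential_Supremum" "HOL-Probability.Probability_Measure"
begin

text \<open>
  Elements of the function spaces below are genuine functions, so that point evaluations make
  sense. Two functions that agree almost everywhere have distance zero.
\<close>

definition l2_inner :: "'y measure \<Rightarrow> ('y \<Rightarrow> real) \<Rightarrow> ('y \<Rightarrow> real) \<Rightarrow> real" where
  "l2_inner \<rho> f g = (\<integral>y. f y * g y \<partial>\<rho>)"

definition l2_norm :: "'y measure \<Rightarrow> ('y \<Rightarrow> real) \<Rightarrow> real" where
  "l2_norm \<rho> f = sqrt (\<integral>y. (f y)\<^sup>2 \<partial>\<rho>)"

definition weight_function :: "'y measure \<Rightarrow> ('y \<Rightarrow> real) \<Rightarrow> bool" where
  "weight_function \<rho> w \<longleftrightarrow>
     w \<in> borel_measurable \<rho> \<and> (AE y in \<rho>. 0 < w y) \<and> (\<integral>\<^sup>+y. ennreal (1 / w y) \<partial>\<rho>) = 1"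

definition weighted_sup_norm :: "'y measure \<Rightarrow> ('y \<Rightarrow> real) \<Rightarrow> ('y \<Rightarrow> real) \<Rightarrow> ereal" where
  "weighted_sup_norm \<rho> w v = esssup \<rho> (\<lambda>y. ereal (sqrt (w y) * \<bar>v y\<bar>))"

definition L_infinity :: "'y measure \<Rightarrow> ('y \<Rightarrow> real) set" where
  "L_infinity \<rho> = {v \<in> borel_measurable \<rho>. esssup \<rho> (\<lambda>y. ereal \<bar>v y\<bar>) < \<infinity>}"

definition V_space :: "'y measure \<Rightarrow> ('y \<Rightarrow> real) \<Rightarrow> ('y \<Rightarrow> real) set" where
  "V_space \<rho> w = {v \<in> L_infinity \<rho>. weighted_sup_norm \<rho> w v < \<infinity>}"

definition V_ball :: "'y measure \<Rightarrow> ('y \<Rightarrow> real) \<Rightarrow> ('y \<Rightarrow> real) \<Rightarrow> real \<Rightarrow> ('y \<Rightarrow> real) set" where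
  "V_ball \<rho> w v r = {f \<in> V_space \<rho> w. l2_norm \<rho> (\<lambda>y. f y - v y) < r}"

text \<open>Zero is removed from \<open>A\<close> in the sense of the function space, i.e. almost everywhere.\<close>

definition unit_normalised :: "'y measure \<Rightarrow> ('y \<Rightarrow> real) set \<Rightarrow> ('y \<Rightarrow> real) set" where
  "unit_normalised \<rho> A = (\<lambda>a y. a y / l2_norm \<rho> a) ` {a \<in> A. \<not> (AE y in \<rho>. a y = 0)}"

definition variation_function :: "'y measure \<Rightarrow> ('y \<Rightarrow> real) set \<Rightarrow> 'y \<Rightarrow> ennreal" where
  "variation_function \<rho> A y = (SUP a\<in>unit_normalised \<rho> A. ennreal (\<bar>a y\<bar>\<^sup>2))"

definition ennreal_sqrt :: "ennreal \<Rightarrow> ennreal" where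
  "ennreal_sqrt x = (if x = \<infinity> then \<infinity> else ennreal (sqrt (enn2real x)))"

definition l2_argmin :: "'y measure \<Rightarrow> ('y \<Rightarrow> real) set \<Rightarrow> ('y \<Rightarrow> real) \<Rightarrow> ('y \<Rightarrow> real) set" where
  "l2_argmin \<rho> A v = {a. is_arg_min (\<lambda>a. l2_norm \<rho> (\<lambda>y. v y - a y)) (\<lambda>a. a \<in> A) a}"

definition proj_dom :: "'y measure \<Rightarrow> ('y \<Rightarrow> real) \<Rightarrow> ('y \<Rightarrow> real) set \<Rightarrow> ('y \<Rightarrow> real) set" where
  "proj_dom \<rho> w A = {v \<in> V_space \<rho> w. \<exists>!a. a \<in> l2_argmin \<rho> A v}"

definition local_reach ::
    "'y measure \<Rightarrow> ('y \<Rightarrow> real) \<Rightarrow> ('y \<Rightarrow> real) set \<Rightarrow> ('y \<Rightarrow> real) \<Rightarrow> ennreal" where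
  "local_reach \<rho> w A v = (SUP r\<in>{r. 0 \<le> r \<and> V_ball \<rho> w v r \<subseteq> proj_dom \<rho> w A}. ennreal r)"

definition function_span :: "('y \<Rightarrow> real) set \<Rightarrow> ('y \<Rightarrow> real) set" where
  "function_span A = {\<lambda>y. \<Sum>f\<in>F. c f * f y | F c. finite F \<and> F \<subseteq> A}"

definition C1_map_on :: "'e::euclidean_space set \<Rightarrow> ('e \<Rightarrow> 'e) \<Rightarrow> bool" where
  "C1_map_on U f \<longleftrightarrow> (\<exists>f' :: 'e \<Rightarrow> 'e \<Rightarrow>\<^sub>L 'e.
     continuous_on U f' \<and> (\<forall>x\<in>U. (f has_derivative blinfun_apply (f' x)) (at x)))"

text \<open>Submanifolds are without boundary and of constant dimension \<open>d\<close> (possibly \<open>0\<close>); around each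
  point, a \<open>C\<^sup>1\<close> diffeomorphism of the ambient space flattens the set to a linear subspace.\<close>

definition C1_submanifold :: "'e::euclidean_space set \<Rightarrow> bool" where
  "C1_submanifold S \<longleftrightarrow> (\<exists>d. \<forall>x\<in>S. \<exists>U V \<Phi> \<Psi> L.
     open U \<and> x \<in> U \<and> open V \<and> homeomorphism U V \<Phi> \<Psi> \<and> C1_map_on U \<Phi> \<and> C1_map_on V \<Psi> \<and>
     subspace L \<and> dim L = d \<and> \<Phi> ` (S \<inter> U) = V \<inter> L)"

definition velocity_space :: "'e::euclidean_space set \<Rightarrow> 'e \<Rightarrow> 'e set" where
  "velocity_space S x = {t. \<exists>\<epsilon>>0. \<exists>\<gamma>. \<gamma> C1_differentiable_on {-\<epsilon><..<\<epsilon>} \<and>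
     \<gamma> ` {-\<epsilon><..<\<epsilon>} \<subseteq> S \<and> \<gamma> 0 = x \<and> (\<gamma> has_vector_derivative t) (at 0)}"

text \<open>
  A finite-dimensional linear subspace of \<open>V_space \<rho> w\<close> that is Euclidean for the \<open>L\<^sup>2\<close> inner
  product is given as the range of a linear isometry \<open>\<iota>\<close> from a Euclidean space. Linearity is
  stated pointwise; preservation of the inner product makes \<open>\<iota>\<close> injective, so that within the
  subspace functions agreeing almost everywhere are equal.
\<close>

definition euclidean_subspace ::
    "'y measure \<Rightarrow> ('y \<Rightarrow> real) \<Rightarrow> ('e::euclidean_space \<Rightarrow> 'y \<Rightarrow> real) \<Rightarrow> bool" where
  "euclidean_subspace \<rho> w \<iota> \<longleftrightarrow>
     (\<forall>y. linear (\<lambda>x. \<iota> x y)) \<and> range \<iota> \<subseteq> V_space \<rho> w \<and>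
     (\<forall>x x'. l2_inner \<rho> (\<iota> x) (\<iota> x') = x \<bullet> x')"

definition manifold_in :: "('e::euclidean_space \<Rightarrow> 'y \<Rightarrow> real) \<Rightarrow> ('y \<Rightarrow> real) set \<Rightarrow> bool" where
  "manifold_in \<iota> N \<longleftrightarrow> N \<subseteq> range \<iota> \<and> C1_submanifold (\<iota> -` N)"

definition tangent_space ::
    "('e::euclidean_space \<Rightarrow> 'y \<Rightarrow> real) \<Rightarrow> ('y \<Rightarrow> real) set \<Rightarrow> ('y \<Rightarrow> real) \<Rightarrow> ('y \<Rightarrow> real) set" where
  "tangent_space \<iota> N v = {\<iota> t | t x. \<iota> x = v \<and> t \<in> velocity_space (\<iota> -` N) x}"

definition tangent_complement ::
    "'y measure \<Rightarrow> ('e::euclidean_space \<Rightarrow> 'y \<Rightarrow> real) \<Rightarrow> ('y \<Rightarrow> real) set \<Rightarrow> ('y \<Rightarrow> real) \<Rightarrow>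
     ('y \<Rightarrow> real) set" where
  "tangent_complement \<rho> \<iota> N v = {n \<in> function_span N. \<forall>t\<in>tangent_space \<iota> N v. l2_inner \<rho> n t = 0}"

end

(* Split x - z, for z in the manifold and x the base point, into a tangential part t and a normal
part n. The claim follows from the pointwise bounds for t and n and from Federer's inequality
2 R |n| <= |x - z|^2. For the latter one needs that x stays the nearest point of x + h m for every
normal unit vector m and every h < R. As the reach is assumed at x only and the manifold is merely
C^1, this is shown by connectedness in h: the condition is closed because the projection is
continuous on the ball, and open by invariance of domain, applied to the map that sends p to its
foot point together with the normal part of p minus its foot point. *)

theory Submission
  imports Defs
begin

section \<open>Nearest points and continuity of the metric projection on a ball\<close>

definition nearest_points :: "'a::metric_space set \<Rightarrow> 'a \<Rightarrow> 'a set" where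
  "nearest_points S p = {q \<in> S. \<forall>z\<in>S. dist p q \<le> dist p z}"

text \<open>If \<open>q\<close> were a limit point outside \<open>S\<close>, then \<open>p\<close> moved slightly towards \<open>q\<close> would have \<open>q\<close> as
  its only nearest point in the closure, and none in \<open>S\<close>.\<close>

lemma nearest_points_closure_subset:
  fixes S :: "'a::euclidean_space set"
  assumes near: "\<And>p. p \<in> ball x s \<Longrightarrow> nearest_points S p = {P p}"
    and p: "p \<in> ball x s" and q: "q \<in> closure S" and le: "dist p q \<le> dist p (P p)"
  shows "q = P p"
proof (rule ccontr)
  assume neq: "q \<noteq> P p"
  have P: "P p \<in> S" "\<And>z. z \<in> S \<Longrightarrow> dist p (P p) \<le> dist p z" if "p \<in> ball x s" for p
    using near[OF that] unfolding nearest_points_def by auto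
  have Pcl: "dist p (P p) \<le> dist p z" if "p \<in> ball x s" "z \<in> closure S" for p z
  proof (rule continuous_ge_on_closure[of S "dist p" z "dist p (P p)"])
    show "continuous_on (closure S) (dist p)" by (intro continuous_intros)
  qed (use that P in blast)+
  have qS: "q \<notin> S"
  proof
    assume "q \<in> S"
    then have "q \<in> nearest_points S p"
      using le P(2)[OF p] unfolding nearest_points_def by force
    with neq near[OF p] show False by auto
  qed
  have pq: "p \<noteq> q"
  proof
    assume "p = q"
    then have "dist p (P p) \<le> 0" using Pcl[OF p q] by simp
    with \<open>p = q\<close> neq show False by simp
  qed
  obtain e where e: "e > 0" "ball p e \<subseteq> ball x s"
    using p open_ball open_contains_ball by blast
  \<comment> \<open>The bound \<open>1/2\<close> places \<open>p'\<close> strictly between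
    \<open>p\<close> and \<open>q\<close>; the other bound makes the step from \<open>p\<close> to
    \<open>p'\<close> shorter than \<open>e\<close>, so that \<open>p'\<close> still has a unique
    nearest point.\<close>
  define c where "c = min (1/2) (e / (2 * dist p q))"
  have c: "0 < c" "c \<le> 1/2" using e pq by (auto simp: c_def)
  have ce: "c * dist p q < e"
  proof -
    have "c * dist p q \<le> e / (2 * dist p q) * dist p q"
      by (intro mult_right_mono) (auto simp: c_def)
    also have "\<dots> < e" using e pq by simp
    finally show ?thesis .
  qed
  define p' where "p' = p + c *\<^sub>R (q - p)"
  have dp: "dist p p' = c * dist p q"
    using c by (simp add: p'_def dist_norm norm_minus_commute)
  have p'q: "p' - q = (1 - c) *\<^sub>R (p - q)" by (simp add: p'_def algebra_simps)
  have dq: "dist p' q = (1 - c) * dist p q" unfolding dist_norm p'q using c by simp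
  have "p' \<in> ball p e" using ce dp by simp
  then have p': "p' \<in> ball x s" using e by blast
  let ?z = "P p'"
  have z: "?z \<in> S" using P p' by blast
  have zq: "dist p' ?z \<le> dist p' q" using Pcl[OF p' q] .
  have sum: "dist p q = dist p p' + dist p' q" using dp dq by (simp add: algebra_simps)
  have "dist p q \<le> dist p ?z" using le P(2)[OF p z] by simp
  \<comment> \<open>The path from \<open>p\<close> via \<open>p'\<close> to \<open>?z\<close> is at
    most as long as \<open>dist p q\<close>, which in turn is at most \<open>dist p ?z\<close>.
    Hence every inequality in this chain is an equality.\<close>
  with sum zq dist_triangle[of p ?z p'] have
    e1: "dist p' ?z = dist p' q" and e2: "dist p ?z = dist p p' + dist p' ?z" by linarith+
  \<comment> \<open>Equality in the triangle inequality puts \<open>?z\<close> and \<open>q\<close>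
    on the ray from \<open>p\<close> through \<open>p'\<close>, beyond \<open>p'\<close>. As their
    distances to \<open>p'\<close> agree, they coincide.\<close>
  have "norm (p - p') *\<^sub>R (p' - ?z) = norm (p' - ?z) *\<^sub>R (p - p')"
    using e2 unfolding dist_triangle_eq .
  moreover have "norm (p - p') *\<^sub>R (p' - q) = norm (p' - q) *\<^sub>R (p - p')"
    using sum unfolding dist_triangle_eq .
  ultimately have "norm (p - p') *\<^sub>R (p' - ?z) = norm (p - p') *\<^sub>R (p' - q)"
    using e1 by (simp add: dist_norm)
  moreover have "norm (p - p') \<noteq> 0" using dp c pq by (simp add: dist_norm)
  ultimately have "?z = q" by simp
  with z qS show False by simp
qed

text \<open>Compactness: if the foot points of a convergent sequence stayed away from
  \<open>P a\<close>, a subsequence of them would converge to some \<open>q\<close> that is at most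
  as far from \<open>a\<close> as \<open>P a\<close>. Since \<open>S\<close> is not assumed closed,
  \<open>q\<close> is only known to lie in the closure; \<open>nearest_points_closure_subset\<close>
  still gives \<open>q = P a\<close>.\<close>

lemma nearest_point_continuous:
  fixes S :: "'a::euclidean_space set"
  assumes near: "\<And>p. p \<in> ball x s \<Longrightarrow> nearest_points S p = {P p}"
  shows "continuous_on (ball x s) P"
proof (rule continuous_on_sequentiallyI)
  fix u a
  assume u: "\<forall>n. u n \<in> ball x s" and a: "a \<in> ball x s" and lim: "u \<longlonglongrightarrow> a"
  have P: "P p \<in> S" "\<And>z. z \<in> S \<Longrightarrow> dist p (P p) \<le> dist p z" if "p \<in> ball x s" for p
    using near[OF that] unfolding nearest_points_def by auto
  show "(\<lambda>n. P (u n)) \<longlonglongrightarrow> P a"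
  proof (rule ccontr)
    assume "\<not> ?thesis"
    then obtain e where e: "e > 0" "\<not> (\<forall>\<^sub>F n in sequentially. dist (P (u n)) (P a) < e)"
      unfolding tendsto_iff by auto
    then have "\<exists>\<^sub>F n in sequentially. e \<le> dist (P (u n)) (P a)"
      by (simp add: frequently_def not_le)
    then have inf: "infinite {n. e \<le> dist (P (u n)) (P a)}"
      by (simp add: frequently_cofinite cofinite_eq_sequentially[symmetric])
    obtain k :: "nat \<Rightarrow> nat" where k: "strict_mono k" "\<forall>n. k n \<in> {n. e \<le> dist (P (u n)) (P a)}"
      using infinite_enumerate[OF inf] by blast
    from k(2) have ek: "e \<le> dist (P (u (k n))) (P a)" for n by simp
    have "bounded (range (\<lambda>n. P (u (k n))))"
    proof (rule boundedI)
      fix y assume "y \<in> range (\<lambda>n. P (u (k n)))"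
      then obtain n where y: "y = P (u (k n))" by auto
      \<comment> \<open>The fixed point \<open>P a\<close> of \<open>S\<close> competes with every
        foot point, which bounds the whole sequence.\<close>
      have h: "dist (u (k n)) y \<le> dist (u (k n)) (P a)"
        using P(2)[of "u (k n)" "P a"] P(1)[OF a] u y by simp
      have "norm y = dist y 0" by simp
      also have "\<dots> \<le> dist y (u (k n)) + dist (u (k n)) 0" by (rule dist_triangle)
      also have "\<dots> \<le> dist (u (k n)) 0 + (dist (u (k n)) 0 + dist 0 (P a))"
        using h dist_triangle[of "u (k n)" "P a" 0] by (simp add: dist_commute)
      also have "dist (u (k n)) 0 \<le> dist x 0 + s"
        using u[rule_format, of "k n"] dist_triangle[of "u (k n)" 0 x] by (auto simp: dist_commute)
      finally show "norm y \<le> (dist x 0 + s) + ((dist x 0 + s) + dist 0 (P a))" by simp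
    qed
    then obtain q j where j: "strict_mono j" "((\<lambda>n. P (u (k n))) \<circ> j) \<longlonglongrightarrow> q"
      using bounded_imp_convergent_subsequence by blast
    then have q: "(\<lambda>n. P (u (k (j n)))) \<longlonglongrightarrow> q" by (simp add: o_def)
    have uj: "(\<lambda>n. u (k (j n))) \<longlonglongrightarrow> a"
      using LIMSEQ_subseq_LIMSEQ[OF lim strict_mono_o[OF k(1) j(1)]] by (simp add: o_def)
    have "q \<in> closure S"
      unfolding closure_sequential using q P(1) u by (intro exI[of _ "\<lambda>n. P (u (k (j n)))"]) auto
    moreover have "dist a q \<le> dist a (P a)"
    proof (rule LIMSEQ_le[OF tendsto_dist[OF uj q] tendsto_dist[OF uj tendsto_const]])
      show "\<exists>N. \<forall>n\<ge>N. dist (u (k (j n))) (P (u (k (j n)))) \<le> dist (u (k (j n))) (P a)"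
        using P(2)[OF u[rule_format] P(1)[OF a]] by blast
    qed
    ultimately have "q = P a" using nearest_points_closure_subset[OF near a] by blast
    moreover have "e \<le> dist q (P a)"
      by (rule LIMSEQ_le_const[OF tendsto_dist[OF q tendsto_const]]) (use ek in blast)
    ultimately show False using e by simp
  qed
qed

section \<open>Velocity vectors, first-order optimality and orthogonal projection\<close>

lemma vector_derivative_in_subspace:
  fixes \<gamma> :: "real \<Rightarrow> 'a::euclidean_space"
  assumes "subspace L" "\<forall>\<^sub>F s in at 0. \<gamma> s \<in> L" "\<gamma> 0 \<in> L"
    and der: "(\<gamma> has_vector_derivative t) (at 0)"
  shows "t \<in> L"
proof (rule Lim_in_closed_set)
  show "closed L" using assms(1) by (rule closed_subspace)
  show "((\<lambda>h. (\<gamma> h - \<gamma> 0) /\<^sub>R h) \<longlongrightarrow> t) (at 0)"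
  proof -
    have "((\<lambda>y. (\<gamma> y - (\<gamma> 0 + y *\<^sub>R t)) /\<^sub>R \<bar>y\<bar>) \<longlongrightarrow> 0) (at 0)"
      using der unfolding has_vector_derivative_def has_derivative_at_within
      by (simp add: diff_diff_eq)
    \<comment> \<open>The definition of the derivative divides by \<open>\<bar>y\<bar>\<close>, the
      difference quotient by \<open>y\<close>. The two differ by a sign only, so the limit is
      compared through norms.\<close>
    then have "((\<lambda>y. norm ((\<gamma> y - (\<gamma> 0 + y *\<^sub>R t)) /\<^sub>R \<bar>y\<bar>)) \<longlongrightarrow> 0) (at 0)"
      using tendsto_norm_zero by blast
    moreover have "\<forall>\<^sub>F y in at 0. norm ((\<gamma> y - (\<gamma> 0 + y *\<^sub>R t)) /\<^sub>R \<bar>y\<bar>)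
        = norm ((\<gamma> y - \<gamma> 0) /\<^sub>R y - t)"
    proof (rule eventually_at_filter[THEN iffD2, OF always_eventually], intro allI impI)
      fix y :: real assume "y \<noteq> 0"
      have "norm ((\<gamma> y - \<gamma> 0) /\<^sub>R y - t) = norm ((\<gamma> y - (\<gamma> 0 + y *\<^sub>R t)) /\<^sub>R y)"
        using \<open>y \<noteq> 0\<close> by (simp add: algebra_simps)
      then show "norm ((\<gamma> y - (\<gamma> 0 + y *\<^sub>R t)) /\<^sub>R \<bar>y\<bar>) = norm ((\<gamma> y - \<gamma> 0) /\<^sub>R y - t)"
        by simp
    qed
    ultimately have "((\<lambda>y. norm ((\<gamma> y - \<gamma> 0) /\<^sub>R y - t)) \<longlongrightarrow> 0) (at 0)"
      by (rule Lim_transform_eventually)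
    then show ?thesis by (rule LIM_zero_cancel[OF tendsto_norm_zero_cancel])
  qed
  show "\<forall>\<^sub>F s in at 0. (\<gamma> s - \<gamma> 0) /\<^sub>R s \<in> L"
    using assms(2) by eventually_elim (simp add: assms subspace_diff subspace_scale)
qed simp

text \<open>This places the tangential part of \<open>x - z\<close>, and therefore also the normal
  part, in the span of the manifold, which is where \<open>tangent_complement\<close> looks for
  normal vectors.\<close>

lemma velocity_space_subset_span:
  fixes S :: "'e::euclidean_space set"
  shows "velocity_space S x \<subseteq> span S"
proof
  fix t assume "t \<in> velocity_space S x"
  then obtain \<epsilon> \<gamma> where e: "\<epsilon> > 0" "\<gamma> ` {-\<epsilon><..<\<epsilon>} \<subseteq> S" "(\<gamma> has_vector_derivative t) (at 0)"
    unfolding velocity_space_def by auto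
  have S: "\<gamma> s \<in> span S" if "s \<in> {-\<epsilon><..<\<epsilon>}" for s
    using e(2) that span_base by blast
  have "\<forall>\<^sub>F s in at 0. s \<in> {-\<epsilon><..<\<epsilon>}"
    using e(1) by (intro eventually_at_in_open') auto
  then have "\<forall>\<^sub>F s in at 0. \<gamma> s \<in> span S" using S by (rule eventually_mono)
  moreover have "\<gamma> 0 \<in> span S" using S e(1) by simp
  ultimately show "t \<in> span S"
    using vector_derivative_in_subspace[OF subspace_span _ _ e(3)] by blast
qed

text \<open>Along a curve in \<open>S\<close> through \<open>q\<close> the squared distance to
  \<open>p\<close> is minimal at parameter 0, where its derivative is
  \<open>-2 * ((p - q) \<bullet> t)\<close>.\<close>

lemma nearest_point_orthogonal_velocity:
  fixes S :: "'e::euclidean_space set"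
  assumes q: "q \<in> nearest_points S p" and t: "t \<in> velocity_space S q"
  shows "(p - q) \<bullet> t = 0"
proof -
  obtain \<epsilon> \<gamma> where e: "\<epsilon> > 0" "\<gamma> ` {-\<epsilon><..<\<epsilon>} \<subseteq> S" "\<gamma> 0 = q"
    "(\<gamma> has_vector_derivative t) (at 0)"
    using t unfolding velocity_space_def by auto
  have "((\<lambda>s. (p - \<gamma> s) \<bullet> (p - \<gamma> s)) has_derivative
      (\<lambda>h. (p - \<gamma> 0) \<bullet> (- (h *\<^sub>R t)) + (- (h *\<^sub>R t)) \<bullet> (p - \<gamma> 0))) (at 0)"
    using e(4) unfolding has_vector_derivative_def by (auto intro!: derivative_eq_intros)
  moreover have "\<forall>s\<in>{-\<epsilon><..<\<epsilon>}. (p - \<gamma> 0) \<bullet> (p - \<gamma> 0) \<le> (p - \<gamma> s) \<bullet> (p - \<gamma> s)"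
  proof
    fix s assume "s \<in> {-\<epsilon><..<\<epsilon>}"
    then have "\<gamma> s \<in> S" using e by blast
    then have "dist p q \<le> dist p (\<gamma> s)" using q unfolding nearest_points_def by blast
    then show "(p - \<gamma> 0) \<bullet> (p - \<gamma> 0) \<le> (p - \<gamma> s) \<bullet> (p - \<gamma> s)"
      using e(3) by (simp add: dist_norm norm_le)
  qed
  ultimately have "(\<lambda>h. (p - \<gamma> 0) \<bullet> (- (h *\<^sub>R t)) + (- (h *\<^sub>R t)) \<bullet> (p - \<gamma> 0)) = (\<lambda>h. 0)"
    using differential_zero_maxmin[of 0 "{-\<epsilon><..<\<epsilon>}" "\<lambda>s. (p - \<gamma> s) \<bullet> (p - \<gamma> s)"] e(1) by auto
  from fun_cong[OF this, of 1] show ?thesis using e(3) by (simp add: inner_commute)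
qed

text \<open>The orthogonality of the residual determines the projection uniquely, and this
  characterisation yields linearity. Linearity is what later makes the projection
  continuous.\<close>

lemma orthogonal_projection_exists:
  fixes T :: "'a::euclidean_space set"
  assumes "subspace T"
  obtains Q where "linear Q" "\<And>v. Q v \<in> T" "\<And>v t. t \<in> T \<Longrightarrow> (v - Q v) \<bullet> t = 0"
proof -
  have "\<exists>y. y \<in> T \<and> (\<forall>t\<in>T. (v - y) \<bullet> t = 0)" for v
  proof -
    obtain y z where "y \<in> span T" "\<And>w. w \<in> span T \<Longrightarrow> orthogonal z w" "v = y + z"
      using orthogonal_subspace_decomp_exists by blast
    then show ?thesis using assms
      by (intro exI[of _ y]) (auto simp: orthogonal_def span_eq_iff[THEN iffD2])
  qed
  then obtain Q where Q: "\<And>v. Q v \<in> T" "\<And>v t. t \<in> T \<Longrightarrow> (v - Q v) \<bullet> t = 0" by metis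
  have uniq: "Q v = y" if "y \<in> T" "\<And>t. t \<in> T \<Longrightarrow> (v - y) \<bullet> t = 0" for v y
  proof -
    have d: "Q v - y \<in> T" using Q that assms by (simp add: subspace_diff)
    have "(Q v - y) \<bullet> (Q v - y) = (v - y) \<bullet> (Q v - y) - (v - Q v) \<bullet> (Q v - y)"
      by (simp add: algebra_simps)
    then show ?thesis using that(2)[OF d] Q(2)[OF d] by simp
  qed
  have "linear Q"
  proof
    fix a b
    show "Q (a + b) = Q a + Q b"
    proof (rule uniq)
      fix t assume "t \<in> T"
      then show "(a + b - (Q a + Q b)) \<bullet> t = 0"
        using Q(2)[of t a] Q(2)[of t b] by (simp add: algebra_simps)
    qed (simp add: Q subspace_add assms)
  next
    fix c :: real and a
    show "Q (c *\<^sub>R a) = c *\<^sub>R Q a"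
    proof (rule uniq)
      fix t assume "t \<in> T"
      then show "(c *\<^sub>R a - c *\<^sub>R Q a) \<bullet> t = 0"
        using Q(2)[of t a] by (metis inner_scaleR_left mult_zero_right scaleR_diff_right)
    qed (simp add: Q subspace_scale assms)
  qed
  with Q that show thesis by blast
qed

section \<open>Flattening charts and tangent spaces\<close>

text \<open>No base point is fixed, so one chart serves \<open>x\<close> and all foot points near
  \<open>x\<close>. The derivatives take values in the bounded linear maps, so that those at
  different points can be compared in operator norm.\<close>

locale flattening_chart =
  fixes S U V L :: "'e::euclidean_space set" and \<Phi> \<Psi> :: "'e \<Rightarrow> 'e"
    and \<Phi>' \<Psi>' :: "'e \<Rightarrow> 'e \<Rightarrow>\<^sub>L 'e"
  assumes open_U: "open U" and open_V: "open V" and homeo: "homeomorphism U V \<Phi> \<Psi>"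
    and deriv_\<Phi>: "\<And>q. q \<in> U \<Longrightarrow> (\<Phi> has_derivative blinfun_apply (\<Phi>' q)) (at q)"
    and deriv_\<Psi>: "\<And>p. p \<in> V \<Longrightarrow> (\<Psi> has_derivative blinfun_apply (\<Psi>' p)) (at p)"
    and cont_\<Psi>': "continuous_on V \<Psi>'"
    and subspace_L: "subspace L" and flat: "\<Phi> ` (S \<inter> U) = V \<inter> L"
begin

lemma \<Psi>_\<Phi>: "q \<in> U \<Longrightarrow> \<Psi> (\<Phi> q) = q"
  and \<Phi>_in_V: "q \<in> U \<Longrightarrow> \<Phi> q \<in> V"
  and cont_\<Phi>: "continuous_on U \<Phi>"
  using homeo unfolding homeomorphism_def by auto

lemma \<Psi>_in_S: "p \<in> V \<Longrightarrow> p \<in> L \<Longrightarrow> \<Psi> p \<in> S"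
  using flat \<Psi>_\<Phi> by (metis IntD1 IntD2 IntI imageE)

lemma \<Phi>_in_L: "q \<in> S \<Longrightarrow> q \<in> U \<Longrightarrow> \<Phi> q \<in> L"
  using flat by blast

lemma \<Psi>'_\<Phi>':
  assumes "q \<in> U"
  shows "\<Psi>' (\<Phi> q) (\<Phi>' q v) = v"
proof -
  have "((\<lambda>x. \<Psi> (\<Phi> x)) has_derivative (\<lambda>v. \<Psi>' (\<Phi> q) (\<Phi>' q v))) (at q)"
    using has_derivative_compose[OF deriv_\<Phi>[OF assms] deriv_\<Psi>[OF \<Phi>_in_V[OF assms]]] .
  then have "((\<lambda>x. x) has_derivative (\<lambda>v. \<Psi>' (\<Phi> q) (\<Phi>' q v))) (at q)"
    by (rule has_derivative_transform_within_open[OF _ open_U assms]) (rule \<Psi>_\<Phi>)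
  then have "(\<lambda>v. \<Psi>' (\<Phi> q) (\<Phi>' q v)) = (\<lambda>v. v)"
    using has_derivative_unique has_derivative_ident by blast
  then show ?thesis by (rule fun_cong)
qed

text \<open>The chain rule makes the derivative of \<open>\<Psi>\<close> surjective; in finite
  dimension a surjective linear endomorphism is injective.\<close>

lemma \<Psi>'_inj:
  assumes "q \<in> U" "\<Psi>' (\<Phi> q) a = \<Psi>' (\<Phi> q) b"
  shows "a = b"
proof -
  have "surj (blinfun_apply (\<Psi>' (\<Phi> q)))"
    using \<Psi>'_\<Phi>'[OF assms(1)] by (metis surjI)
  then have "inj (blinfun_apply (\<Psi>' (\<Phi> q)))"
    using linear_surjective_imp_injective bounded_linear.linear blinfun.bounded_linear_right by blast
  then show ?thesis using assms(2) by (simp add: inj_eq)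
qed

text \<open>The chart sends a curve in \<open>S\<close> to one that stays in \<open>L\<close> near
  parameter 0, hence so does its velocity. Conversely, \<open>\<Psi>\<close> pulls a straight
  segment in \<open>L\<close> back to a curve in \<open>S\<close>. The formula shows that velocities
  form a subspace, and describes its dependence on \<open>q\<close> by a continuous family of linear
  maps.\<close>

lemma velocity_space_eq:
  assumes q: "q \<in> S" "q \<in> U"
  shows "velocity_space S q = blinfun_apply (\<Psi>' (\<Phi> q)) ` L"
proof (intro equalityI subsetI)
  fix t assume "t \<in> velocity_space S q"
  then obtain \<epsilon> \<gamma> where e: "\<epsilon> > 0" "\<gamma> ` {-\<epsilon><..<\<epsilon>} \<subseteq> S" "\<gamma> 0 = q"
    "(\<gamma> has_vector_derivative t) (at 0)"
    unfolding velocity_space_def by auto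
  have "((\<lambda>s. \<Phi> (\<gamma> s)) has_derivative (\<lambda>h. \<Phi>' q (h *\<^sub>R t))) (at 0)"
    by (rule has_derivative_compose[of \<gamma>])
      (use e deriv_\<Phi>[OF q(2)] in \<open>auto simp: has_vector_derivative_def\<close>)
  then have d: "((\<lambda>s. \<Phi> (\<gamma> s)) has_vector_derivative \<Phi>' q t) (at 0)"
    unfolding has_vector_derivative_def by (simp add: blinfun.scaleR_right)
  have "(\<gamma> \<longlongrightarrow> q) (at 0)"
    using has_vector_derivative_continuous[OF e(4)] e(3) by (simp add: continuous_at)
  then have "\<forall>\<^sub>F s in at 0. \<gamma> s \<in> U" using open_U q(2) by (rule topological_tendstoD)
  moreover have "\<forall>\<^sub>F s in at 0. s \<in> {-\<epsilon><..<\<epsilon>}"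
    using e(1) by (intro eventually_at_in_open') auto
  ultimately have "\<forall>\<^sub>F s in at 0. \<Phi> (\<gamma> s) \<in> L"
    by eventually_elim (use \<Phi>_in_L e(2) in blast)
  then have "\<Phi>' q t \<in> L"
    using vector_derivative_in_subspace[OF subspace_L _ _ d] \<Phi>_in_L q e(3) by simp
  then show "t \<in> blinfun_apply (\<Psi>' (\<Phi> q)) ` L"
    using \<Psi>'_\<Phi>'[OF q(2), of t] by (metis image_eqI)
next
  fix t assume "t \<in> blinfun_apply (\<Psi>' (\<Phi> q)) ` L"
  then obtain l where l: "l \<in> L" "t = \<Psi>' (\<Phi> q) l" by auto
  have "open ((\<lambda>s::real. \<Phi> q + s *\<^sub>R l) -` V)"
    by (intro continuous_open_vimage open_V) (auto intro!: continuous_intros)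
  moreover have "0 \<in> (\<lambda>s::real. \<Phi> q + s *\<^sub>R l) -` V" using \<Phi>_in_V q by simp
  ultimately obtain e where e: "e > 0" "ball 0 e \<subseteq> (\<lambda>s::real. \<Phi> q + s *\<^sub>R l) -` V"
    using open_contains_ball by blast
  have V: "\<Phi> q + s *\<^sub>R l \<in> V" if "s \<in> {-e<..<e}" for s
    using e(2) that by (auto simp: subset_iff dist_real_def)
  define \<gamma> where "\<gamma> = (\<lambda>s. \<Psi> (\<Phi> q + s *\<^sub>R l))"
  have d: "(\<gamma> has_vector_derivative \<Psi>' (\<Phi> q + s *\<^sub>R l) l) (at s)" if "s \<in> {-e<..<e}" for s
  proof -
    have "((\<lambda>s. \<Psi> (\<Phi> q + s *\<^sub>R l)) has_derivative (\<lambda>h. \<Psi>' (\<Phi> q + s *\<^sub>R l) (h *\<^sub>R l))) (at s)"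
      by (rule has_derivative_compose[of "\<lambda>s. \<Phi> q + s *\<^sub>R l"])
        (use deriv_\<Psi>[OF V[OF that]] in \<open>auto intro!: derivative_eq_intros\<close>)
    then show ?thesis
      unfolding has_vector_derivative_def \<gamma>_def by (simp add: blinfun.scaleR_right)
  qed
  have "continuous_on {-e<..<e} (\<lambda>s. \<Psi>' (\<Phi> q + s *\<^sub>R l))"
    by (rule continuous_on_compose2[OF cont_\<Psi>']) (use V in \<open>auto intro!: continuous_intros\<close>)
  then have "continuous_on {-e<..<e} (\<lambda>s. \<Psi>' (\<Phi> q + s *\<^sub>R l) l)"
    by (intro continuous_intros)
  with d have C1: "\<gamma> C1_differentiable_on {-e<..<e}"
    unfolding C1_differentiable_on_def
    by (intro exI[of _ "\<lambda>s. \<Psi>' (\<Phi> q + s *\<^sub>R l) l"]) simp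
  have "\<Phi> q + s *\<^sub>R l \<in> L" for s
    using l \<Phi>_in_L[OF q] subspace_L by (simp add: subspace_add subspace_scale)
  then have "\<gamma> ` {-e<..<e} \<subseteq> S" unfolding \<gamma>_def using \<Psi>_in_S V by blast
  moreover have "\<gamma> 0 = q" using \<Psi>_\<Phi> q by (simp add: \<gamma>_def)
  moreover have "(\<gamma> has_vector_derivative t) (at 0)" using d[of 0] e(1) l by simp
  ultimately show "t \<in> velocity_space S q"
    unfolding velocity_space_def using e(1) C1 by blast
qed

lemma subspace_velocity_space:
  assumes "q \<in> S" "q \<in> U"
  shows "subspace (velocity_space S q)"
  unfolding velocity_space_eq[OF assms]
  using subspace_L bounded_linear.linear blinfun.bounded_linear_right
  by (intro linear_subspace_image) blast+

text \<open>Write \<open>\<nu>\<close> as the image of \<open>l\<close> under the derivative of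
  \<open>\<Psi>\<close> at \<open>\<Phi> x\<close>. The image of the same \<open>l\<close> at
  \<open>\<Phi> q\<close> is orthogonal to \<open>\<nu>\<close>, yet close to \<open>\<nu>\<close>
  when \<open>q\<close> is near \<open>x\<close>, which forces \<open>\<nu> = 0\<close>.\<close>

lemma normal_spaces_transversal:
  assumes x: "x \<in> S" "x \<in> U"
  obtains W where "open W" "x \<in> W" "W \<subseteq> U"
    "\<And>q \<nu>. \<lbrakk>q \<in> S; q \<in> W; \<nu> \<in> velocity_space S x; \<And>t. t \<in> velocity_space S q \<Longrightarrow> \<nu> \<bullet> t = 0\<rbrakk> \<Longrightarrow> \<nu> = 0"
proof -
  \<comment> \<open>The summand 1 makes \<open>K\<close> positive and
    \<open>norm (\<Phi>' x) / K\<close> strictly less than 1, which is the contraction factor in the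
    final estimate.\<close>
  define K where "K = norm (\<Phi>' x) + 1"
  have K: "K > 0" by (simp add: K_def add_nonneg_pos)
  have "continuous_on U (\<lambda>q. \<Psi>' (\<Phi> q))"
    by (rule continuous_on_compose2[OF cont_\<Psi>' cont_\<Phi>]) (use \<Phi>_in_V in blast)
  then have cont: "continuous_on U (\<lambda>q. dist (\<Psi>' (\<Phi> q)) (\<Psi>' (\<Phi> x)))"
    by (intro continuous_intros)
  define W where "W = U \<inter> (\<lambda>q. dist (\<Psi>' (\<Phi> q)) (\<Psi>' (\<Phi> x))) -` {..<1/K}"
  have "open W" unfolding W_def by (rule continuous_open_preimage[OF cont open_U]) simp
  show thesis
  proof (rule that[OF \<open>open W\<close>])
    show "x \<in> W" "W \<subseteq> U" using x K by (auto simp: W_def)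
    fix q \<nu>
    assume q: "q \<in> S" "q \<in> W" and \<nu>: "\<nu> \<in> velocity_space S x"
      "\<And>t. t \<in> velocity_space S q \<Longrightarrow> \<nu> \<bullet> t = 0"
    have qU: "q \<in> U" using q by (simp add: W_def)
    obtain l where l: "l \<in> L" "\<nu> = \<Psi>' (\<Phi> x) l"
      using \<nu>(1) velocity_space_eq[OF x] by auto
    have l': "l = \<Phi>' x \<nu>" using \<Psi>'_inj[OF x(2), of l "\<Phi>' x \<nu>"] \<Psi>'_\<Phi>'[OF x(2)] l by simp
    have nl: "norm l \<le> norm (\<Phi>' x) * norm \<nu>" unfolding l' by (rule norm_blinfun)
    have "\<nu> \<bullet> \<Psi>' (\<Phi> q) l = 0" using \<nu>(2) velocity_space_eq[OF q(1) qU] l by blast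
    then have "\<nu> \<bullet> \<nu> = \<nu> \<bullet> ((\<Psi>' (\<Phi> x) - \<Psi>' (\<Phi> q)) l)"
      using l by (simp add: blinfun.diff_left inner_diff_right)
    also have "\<dots> \<le> norm \<nu> * norm ((\<Psi>' (\<Phi> x) - \<Psi>' (\<Phi> q)) l)" by (rule norm_cauchy_schwarz)
    also have "\<dots> \<le> norm \<nu> * (norm (\<Psi>' (\<Phi> x) - \<Psi>' (\<Phi> q)) * norm l)"
      by (intro mult_left_mono norm_blinfun) simp
    also have "\<dots> \<le> norm \<nu> * (1/K * (norm (\<Phi>' x) * norm \<nu>))"
      using q(2) nl K unfolding W_def
      by (intro mult_left_mono mult_mono) (auto simp: dist_norm norm_minus_commute)
    finally have "norm \<nu> * norm \<nu> \<le> norm (\<Phi>' x) / K * (norm \<nu> * norm \<nu>)"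
      by (simp add: dot_square_norm power2_eq_square algebra_simps)
    moreover have "norm (\<Phi>' x) / K < 1" using K by (simp add: K_def)
    ultimately have "\<not> 0 < norm \<nu> * norm \<nu>"
      using mult_strict_right_mono[of "norm (\<Phi>' x) / K" 1 "norm \<nu> * norm \<nu>"] by linarith
    then show "\<nu> = 0" by (simp add: zero_less_mult_iff)
  qed
qed

section \<open>Foot points along normal rays and Federer's inequality\<close>

text \<open>The map \<open>H\<close> below records the foot point \<open>P p\<close> in the tangential coordinates and the offset
  \<open>p - P p\<close> in the normal coordinates at \<open>x\<close>. It is continuous and injective, hence open, so that
  every normal offset close to \<open>p0 - x\<close> is attained over the foot point \<open>x\<close>.\<close>

lemma normal_offset_open:
  assumes near: "\<And>p. p \<in> ball x s \<Longrightarrow> nearest_points S p = {P p}"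
    and x: "x \<in> S" "x \<in> U" and p0: "p0 \<in> ball x s" "P p0 = x"
  obtains \<delta> where "\<delta> > 0"
    "\<And>v. \<lbrakk>\<And>t. t \<in> velocity_space S x \<Longrightarrow> v \<bullet> t = 0; dist (x + v) p0 < \<delta>; x + v \<in> ball x s\<rbrakk> \<Longrightarrow> P (x + v) = x"
proof -
  let ?T = "velocity_space S x"
  have P: "P p \<in> S" "\<And>t. t \<in> velocity_space S (P p) \<Longrightarrow> (p - P p) \<bullet> t = 0" if "p \<in> ball x s" for p
    using near[OF that] nearest_point_orthogonal_velocity[of "P p" S p]
    unfolding nearest_points_def by auto
  obtain W where W: "open W" "x \<in> W" "W \<subseteq> U"
    "\<And>q \<nu>. \<lbrakk>q \<in> S; q \<in> W; \<nu> \<in> ?T; \<And>t. t \<in> velocity_space S q \<Longrightarrow> \<nu> \<bullet> t = 0\<rbrakk> \<Longrightarrow> \<nu> = 0"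
    using normal_spaces_transversal[OF x] by blast
  have T: "subspace ?T" by (rule subspace_velocity_space[OF x])
  obtain Q where Q: "linear Q" "\<And>v. Q v \<in> ?T" "\<And>v t. t \<in> ?T \<Longrightarrow> (v - Q v) \<bullet> t = 0"
    using orthogonal_projection_exists[OF T] by blast
  have Qn: "Q v = 0" if "\<And>t. t \<in> ?T \<Longrightarrow> v \<bullet> t = 0" for v
  proof -
    have "Q v \<bullet> Q v = v \<bullet> Q v - (v - Q v) \<bullet> Q v" by (simp add: algebra_simps)
    then show ?thesis using that Q by simp
  qed
  have contP: "continuous_on (ball x s) P" by (rule nearest_point_continuous[OF near])
  \<comment> \<open>On \<open>A\<close> the foot points lie in \<open>W\<close>, where both the
    chart and the transversality of the normal spaces are available.\<close>
  define A where "A = ball x s \<inter> P -` W"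
  have A: "open A" unfolding A_def
    by (rule continuous_open_preimage[OF contP open_ball W(1)])
  \<comment> \<open>Applying the derivative of \<open>\<Psi>\<close> moves the coordinates from
    \<open>L\<close> into \<open>?T\<close>. The two summands are then orthogonal, and
    \<open>H\<close> maps into the ambient space itself, as invariance of domain requires.\<close>
  define H where "H p = \<Psi>' (\<Phi> x) (\<Phi> (P p)) + (p - P p - Q (p - P p))" for p
  \<comment> \<open>Uniqueness of the orthogonal decomposition along \<open>?T\<close>: a value of
    \<open>H\<close> determines both of its summands.\<close>
  have split: "a = a' \<and> b = b'"
    if "a \<in> ?T" "a' \<in> ?T" "\<And>t. t \<in> ?T \<Longrightarrow> b \<bullet> t = 0" "\<And>t. t \<in> ?T \<Longrightarrow> b' \<bullet> t = 0" "a + b = a' + b'"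
    for a a' b b'
  proof -
    have d: "a - a' \<in> ?T" using that T by (simp add: subspace_diff)
    have "(a - a') \<bullet> (a - a') = (b' - b) \<bullet> (a - a')"
      using that(5) by (metis add_diff_cancel_left add_diff_eq diff_add_eq diff_diff_eq2 add.commute)
    also have "\<dots> = 0" using that(3)[OF d] that(4)[OF d] by (simp add: inner_diff_left)
    finally show ?thesis using that(5) by simp
  qed
  have PU: "P p \<in> U" if "p \<in> A" for p using that W(3) by (auto simp: A_def)
  have T1: "\<Psi>' (\<Phi> x) (\<Phi> (P p)) \<in> ?T" if "p \<in> A" for p
    using that P W(3) \<Phi>_in_L velocity_space_eq[OF x] by (auto simp: A_def)
  have contPA: "continuous_on A P"
    using contP by (rule continuous_on_subset) (simp add: A_def)
  have "continuous_on A (\<lambda>p. \<Phi> (P p))"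
    by (rule continuous_on_compose2[OF cont_\<Phi> contPA]) (use PU in blast)
  moreover have "continuous_on A (\<lambda>p. Q (p - P p))"
    by (rule linear_continuous_on_compose[OF _ Q(1)]) (intro continuous_intros contPA)
  ultimately have contH: "continuous_on A H"
    unfolding H_def by (intro continuous_intros contPA)
  have injH: "inj_on H A"
  proof (rule inj_onI)
    fix p p' assume p: "p \<in> A" "p' \<in> A" "H p = H p'"
    have "\<Psi>' (\<Phi> x) (\<Phi> (P p)) = \<Psi>' (\<Phi> x) (\<Phi> (P p')) \<and>
        p - P p - Q (p - P p) = p' - P p' - Q (p' - P p')"
      using p(3) by (intro split T1 p(1,2)) (simp_all add: Q(3) H_def del: diff_diff_eq)
    then have eq: "\<Psi>' (\<Phi> x) (\<Phi> (P p)) = \<Psi>' (\<Phi> x) (\<Phi> (P p'))"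
      "p - P p - Q (p - P p) = p' - P p' - Q (p' - P p')" by blast+
    have "\<Phi> (P p) = \<Phi> (P p')" using \<Psi>'_inj[OF x(2) eq(1)] .
    then have q: "P p = P p'" using \<Psi>_\<Phi> PU p(1,2) by metis
    have "p - p' = Q (p - P p) - Q (p' - P p')" using eq(2) q by (simp add: algebra_simps)
    then have pT: "p - p' \<in> ?T" using Q(2) T by (simp add: subspace_diff)
    \<comment> \<open>The difference is tangential at \<open>x\<close> since the normal parts agree,
      and orthogonal to the velocities at the common foot point by first-order optimality.
      Transversality leaves only zero.\<close>
    have "p - p' = 0"
    proof (rule W(4)[of "P p"])
      show "P p \<in> S" "P p \<in> W" using p P by (auto simp: A_def)
      fix t assume "t \<in> velocity_space S (P p)"
      then have "(p - P p) \<bullet> t = 0" "(p' - P p') \<bullet> t = 0"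
        using P(2)[of p t] P(2)[of p' t] p q by (auto simp: A_def)
      then show "(p - p') \<bullet> t = 0" using q by (simp add: inner_diff_left)
    qed (rule pT)
    then show "p = p'" by simp
  qed
  have "open (H ` A)" by (rule invariance_of_domain[OF contH A injH])
  moreover have "H p0 = \<Psi>' (\<Phi> x) (\<Phi> x) + (p0 - x)"
    using p0 P(2)[OF p0(1)] Qn[of "p0 - x"] by (simp add: H_def)
  moreover have "p0 \<in> A" using p0 W by (simp add: A_def)
  ultimately obtain \<delta> where \<delta>: "\<delta> > 0" "ball (\<Psi>' (\<Phi> x) (\<Phi> x) + (p0 - x)) \<delta> \<subseteq> H ` A"
    by (metis image_eqI open_contains_ball)
  show thesis
  proof (rule that[OF \<delta>(1)])
    fix v assume v: "\<And>t. t \<in> ?T \<Longrightarrow> v \<bullet> t = 0" and d: "dist (x + v) p0 < \<delta>"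
    have "dist (\<Psi>' (\<Phi> x) (\<Phi> x) + (p0 - x)) (\<Psi>' (\<Phi> x) (\<Phi> x) + v) = dist (x + v) p0"
      by (simp add: dist_norm norm_minus_commute algebra_simps)
    then have "\<Psi>' (\<Phi> x) (\<Phi> x) + v \<in> H ` A" using d \<delta>(2) by auto
    then obtain p where p: "p \<in> A" "\<Psi>' (\<Phi> x) (\<Phi> x) + v = H p" by auto
    have T0: "\<Psi>' (\<Phi> x) (\<Phi> x) \<in> ?T" using velocity_space_eq[OF x] \<Phi>_in_L[OF x] by blast
    have "\<Psi>' (\<Phi> x) (\<Phi> x) = \<Psi>' (\<Phi> x) (\<Phi> (P p)) \<and> v = p - P p - Q (p - P p)"
      using p(2) by (intro split T0 T1 p(1) v) (simp_all add: Q(3) H_def del: diff_diff_eq)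
    then have eq: "\<Psi>' (\<Phi> x) (\<Phi> x) = \<Psi>' (\<Phi> x) (\<Phi> (P p))" "v = p - P p - Q (p - P p)"
      by blast+
    have "\<Phi> x = \<Phi> (P p)" using \<Psi>'_inj[OF x(2) eq(1)] .
    then have q: "P p = x" using \<Psi>_\<Phi> PU p(1) x(2) by metis
    \<comment> \<open>With foot point \<open>x\<close>, first-order optimality makes
      \<open>p - x\<close> normal at \<open>x\<close>, so the projection onto \<open>?T\<close>
      removes nothing from it and the preimage is \<open>x + v\<close> itself.\<close>
    have "Q (p - P p) = 0" using Qn[of "p - P p"] P(2)[of p] p(1) q by (auto simp: A_def)
    then have "p = x + v" using eq(2) q by simp
    then show "P (x + v) = x" using q by simp
  qed
qed

text \<open>The heights with foot point \<open>x\<close> contain 0, are closed by continuity of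
  \<open>P\<close> and open by \<open>normal_offset_open\<close>; they fill the connected
  interval.\<close>

lemma nearest_point_normal_ray:
  assumes near: "\<And>p. p \<in> ball x s \<Longrightarrow> nearest_points S p = {P p}"
    and x: "x \<in> S" "x \<in> U" and n: "\<And>t. t \<in> velocity_space S x \<Longrightarrow> n \<bullet> t = 0" "norm n = 1"
    and h: "0 \<le> h" "h < s"
  shows "P (x + h *\<^sub>R n) = x"
proof -
  let ?I = "{0..<s}"
  define G where "G = {h \<in> ?I. P (x + h *\<^sub>R n) = x}"
  have ball: "x + h *\<^sub>R n \<in> ball x s" if "h \<in> ?I" for h
    using that n(2) by (simp add: dist_norm)
  have "continuous_on ?I (\<lambda>h. P (x + h *\<^sub>R n))"
    by (rule continuous_on_compose2[OF nearest_point_continuous[OF near]])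
      (use ball in \<open>auto intro!: continuous_intros\<close>)
  then have "closedin (top_of_set ?I) G"
    unfolding G_def by (rule continuous_closedin_preimage_constant)
  moreover have "openin (top_of_set ?I) G"
    unfolding openin_euclidean_subtopology_iff
  proof (intro conjI ballI)
    show "G \<subseteq> ?I" by (auto simp: G_def)
    fix g assume g: "g \<in> G"
    obtain \<delta> where \<delta>: "\<delta> > 0"
      "\<And>v. \<lbrakk>\<And>t. t \<in> velocity_space S x \<Longrightarrow> v \<bullet> t = 0; dist (x + v) (x + g *\<^sub>R n) < \<delta>; x + v \<in> ball x s\<rbrakk>
        \<Longrightarrow> P (x + v) = x"
      using normal_offset_open[OF near x ball] g unfolding G_def by blast
    have "h \<in> G" if "h \<in> ?I" "dist h g < \<delta>" for h
    proof -
      have "dist (x + h *\<^sub>R n) (x + g *\<^sub>R n) = dist h g"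
        using n(2) by (simp add: dist_norm scaleR_diff_left[symmetric])
      then have "P (x + h *\<^sub>R n) = x"
        using \<delta>(2)[of "h *\<^sub>R n"] n(1) that ball by simp
      then show ?thesis using that by (simp add: G_def)
    qed
    then show "\<exists>e>0. \<forall>h\<in>?I. dist h g < e \<longrightarrow> h \<in> G" using \<delta>(1) by blast
  qed
  moreover have "0 \<in> G"
  proof -
    have "0 < s" using h by simp
    then have "nearest_points S x = {P x}" using near by simp
    moreover have "x \<in> nearest_points S x" using x by (simp add: nearest_points_def)
    ultimately show ?thesis using \<open>0 < s\<close> by (simp add: G_def)
  qed
  moreover have "connected ?I" by simp
  ultimately have "G = ?I" unfolding connected_clopen by blast
  then have "h \<in> G" using h by simp
  then show ?thesis unfolding G_def by simp
qed

text \<open>The open ball of radius \<open>h\<close> that touches \<open>S\<close> at \<open>x\<close> from the direction of \<open>-n\<close>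
  contains no point of \<open>S\<close>, in particular not \<open>z\<close>; the claim follows as \<open>h\<close> tends to \<open>s\<close>.\<close>

lemma normal_component_le:
  assumes near: "\<And>p. p \<in> ball x s \<Longrightarrow> nearest_points S p = {P p}"
    and x: "x \<in> S" "x \<in> U" and z: "z \<in> S" and s: "0 \<le> s"
    and n: "\<And>t. t \<in> velocity_space S x \<Longrightarrow> n \<bullet> t = 0" and xz: "x - z = t + n" "t \<in> velocity_space S x"
  shows "2 * s * norm n \<le> (norm (x - z))\<^sup>2"
proof (cases "n = 0")
  case False
  \<comment> \<open>The sign is reversed because \<open>z = x - t - n\<close> lies on the side of
    \<open>- n\<close>.\<close>
  define m where "m = (- 1 / norm n) *\<^sub>R n"
  have m: "norm m = 1" "\<And>t. t \<in> velocity_space S x \<Longrightarrow> m \<bullet> t = 0"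
    using False n by (auto simp: m_def)
  have "h \<le> (norm (x - z))\<^sup>2 / (2 * norm n)" if h: "0 \<le> h" "h < s" for h
  proof -
    have "P (x + h *\<^sub>R m) = x" by (rule nearest_point_normal_ray[OF near x m(2,1) h])
    moreover have "x + h *\<^sub>R m \<in> ball x s" using h m(1) by (simp add: dist_norm)
    ultimately have "x \<in> nearest_points S (x + h *\<^sub>R m)" using near by simp
    then have "dist (x + h *\<^sub>R m) x \<le> dist (x + h *\<^sub>R m) z"
      using z unfolding nearest_points_def by blast
    then have "norm (h *\<^sub>R m) \<le> norm ((x - z) + h *\<^sub>R m)"
      by (simp add: dist_norm algebra_simps)
    then have "(h *\<^sub>R m) \<bullet> (h *\<^sub>R m) \<le> ((x - z) + h *\<^sub>R m) \<bullet> ((x - z) + h *\<^sub>R m)"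
      unfolding norm_le .
    \<comment> \<open>The terms quadratic in \<open>h\<close> cancel, which leaves a bound linear in
      \<open>h\<close>.\<close>
    then have "0 \<le> (norm (x - z))\<^sup>2 + 2 * h * (m \<bullet> (x - z))"
      by (simp add: inner_add_left inner_add_right inner_commute power2_norm_eq_inner)
    moreover have "m \<bullet> (x - z) = - norm n"
    proof -
      have "m \<bullet> (x - z) = m \<bullet> n" using m(2)[OF xz(2)] xz(1) by (simp add: inner_add_right)
      also have "\<dots> = - norm n"
        using False by (simp add: m_def dot_square_norm power2_eq_square)
      finally show ?thesis .
    qed
    ultimately have "h * (2 * norm n) \<le> (norm (x - z))\<^sup>2" by simp
    then show ?thesis using False by (simp add: pos_le_divide_eq)
  qed
  \<comment> \<open>The bound does not depend on \<open>h\<close>, so it passes to the supremum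
    \<open>s\<close>. For \<open>s = 0\<close> no such \<open>h\<close> exists, but the claim is
    then trivial.\<close>
  then have "s \<le> (norm (x - z))\<^sup>2 / (2 * norm n)"
    using s by (cases "s = 0") (auto intro: dense_le_bounded[of 0 s])
  then show ?thesis using False by (simp add: pos_le_divide_eq algebra_simps)
qed simp

end

text \<open>The parts \<open>t\<close> and \<open>n\<close> are chosen before \<open>s\<close> and
  \<open>P\<close>, so that one decomposition satisfies the inequality for every radius that enters
  the supremum in \<open>local_reach\<close>.\<close>

lemma C1_submanifold_reach_decomposition:
  fixes S :: "'e::euclidean_space set"
  assumes S: "C1_submanifold S" and x: "x \<in> S" and z: "z \<in> S"
  obtains t n where "t \<in> velocity_space S x" "x - z = t + n" "norm t \<le> norm (x - z)"
    "\<And>t'. t' \<in> velocity_space S x \<Longrightarrow> n \<bullet> t' = 0" "n \<in> span S"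
    "\<And>s P. \<lbrakk>0 \<le> s; \<And>p. p \<in> ball x s \<Longrightarrow> nearest_points S p = {P p}\<rbrakk>
      \<Longrightarrow> 2 * s * norm n \<le> (norm (x - z))\<^sup>2"
proof -
  obtain U V \<Phi> \<Psi> L where chart: "open U" "x \<in> U" "open V" "homeomorphism U V \<Phi> \<Psi>"
    "C1_map_on U \<Phi>" "C1_map_on V \<Psi>" "subspace L" "\<Phi> ` (S \<inter> U) = V \<inter> L"
    using S unfolding C1_submanifold_def
    by (elim exE) (drule bspec[OF _ x], elim exE conjE, rule that)
  obtain \<Phi>' where \<Phi>': "\<And>q. q \<in> U \<Longrightarrow> (\<Phi> has_derivative blinfun_apply (\<Phi>' q)) (at q)"
    using chart(5) unfolding C1_map_on_def by blast
  obtain \<Psi>' where \<Psi>': "continuous_on V \<Psi>'"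
    "\<And>q. q \<in> V \<Longrightarrow> (\<Psi> has_derivative blinfun_apply (\<Psi>' q)) (at q)"
    using chart(6) unfolding C1_map_on_def by blast
  interpret flattening_chart S U V L \<Phi> \<Psi> \<Phi>' \<Psi>'
    using chart(1,3,4,7,8) \<Phi>' \<Psi>' by unfold_locales
  let ?T = "velocity_space S x"
  obtain Q where "linear Q" and Q: "\<And>v. Q v \<in> ?T" "\<And>v t. t \<in> ?T \<Longrightarrow> (v - Q v) \<bullet> t = 0"
    using orthogonal_projection_exists[OF subspace_velocity_space[OF x chart(2)]] by blast
  define t where "t = Q (x - z)"
  define n where "n = x - z - t"
  have t: "t \<in> ?T" and n: "\<And>t'. t' \<in> ?T \<Longrightarrow> n \<bullet> t' = 0" and eq: "x - z = t + n"
    using Q by (simp_all add: t_def n_def)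
  have "n \<bullet> t = 0" using n[OF t] .
  then have "(norm (x - z))\<^sup>2 = (norm t)\<^sup>2 + (norm n)\<^sup>2"
    unfolding eq power2_norm_eq_inner by (simp add: inner_add_left inner_add_right inner_commute)
  then have "norm t \<le> norm (x - z)"
    using power2_le_imp_le[of "norm t" "norm (x - z)"] by simp
  moreover have "n \<in> span S"
    unfolding n_def using velocity_space_subset_span t x z by (meson span_base span_diff subsetD)
  moreover have "2 * s * norm n \<le> (norm (x - z))\<^sup>2"
    if "0 \<le> s" "\<And>p. p \<in> ball x s \<Longrightarrow> nearest_points S p = {P p}" for s P
    by (rule normal_component_le[OF that(2) x chart(2) z that(1) n eq t])
  ultimately show thesis using that[OF t eq] n by blast
qed

section \<open>Variation functions and the isometric Euclidean model\<close>

lemma le_ennreal_sqrt: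
  assumes "ennreal (b\<^sup>2) \<le> k" "0 \<le> b"
  shows "ennreal b \<le> ennreal_sqrt k"
proof (cases k)
  case (real c)
  then have "b \<le> sqrt c" using assms by (intro real_le_rsqrt) simp
  then show ?thesis using real by (simp add: ennreal_sqrt_def ennreal_leI)
qed (simp add: ennreal_sqrt_def)

lemma variation_function_leI:
  assumes "\<And>a. a \<in> unit_normalised \<rho> A \<Longrightarrow> ennreal (\<bar>a y\<bar>\<^sup>2) \<le> c"
  shows "variation_function \<rho> A y \<le> c"
  unfolding variation_function_def using assms by (rule SUP_least)

locale euclidean_function_space =
  fixes \<rho> :: "'y measure" and w :: "'y \<Rightarrow> real" and \<iota> :: "'e::euclidean_space \<Rightarrow> 'y \<Rightarrow> real"
  assumes euclidean: "euclidean_subspace \<rho> w \<iota>"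
begin

lemma linear_\<iota>: "linear (\<lambda>x. \<iota> x y)"
  and \<iota>_in_V: "\<iota> x \<in> V_space \<rho> w"
  and inner_\<iota>: "l2_inner \<rho> (\<iota> a) (\<iota> b) = a \<bullet> b"
  using euclidean unfolding euclidean_subspace_def by auto

lemma \<iota>_diff: "(\<lambda>y. \<iota> a y - \<iota> b y) = \<iota> (a - b)"
  using linear_diff[OF linear_\<iota>] by fastforce

lemma \<iota>_add: "\<iota> (a + b) y = \<iota> a y + \<iota> b y"
  using linear_add[OF linear_\<iota>] by fastforce

lemma norm_\<iota>: "l2_norm \<rho> (\<iota> a) = norm a"
  using inner_\<iota>[of a a] unfolding l2_norm_def l2_inner_def norm_eq_sqrt_inner
  by (simp add: power2_eq_square)

lemma inj_\<iota>: "inj \<iota>"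
proof (rule injI)
  fix a b assume "\<iota> a = \<iota> b"
  then have "\<iota> (a - b) = (\<lambda>y. 0)" unfolding \<iota>_diff[symmetric] by simp
  then have "norm (a - b) = 0" unfolding norm_\<iota>[symmetric] by (simp add: l2_norm_def)
  then show "a = b" by simp
qed

text \<open>Vanishing almost everywhere forces norm zero in the model. Thus the removal of null
  functions in \<open>unit_normalised\<close> becomes the removal of the zero vector.\<close>

lemma AE_\<iota>_eq_0_iff: "(AE y in \<rho>. \<iota> a y = 0) \<longleftrightarrow> a = 0"
proof
  assume "AE y in \<rho>. \<iota> a y = 0"
  then have "AE y in \<rho>. (\<iota> a y)\<^sup>2 = 0" by eventually_elim simp
  then have "(\<integral>y. (\<iota> a y)\<^sup>2 \<partial>\<rho>) = 0" by (rule integral_eq_zero_AE)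
  then have "l2_norm \<rho> (\<iota> a) = 0" by (simp add: l2_norm_def)
  then show "a = 0" by (simp add: norm_\<iota>)
next
  assume "a = 0"
  then show "AE y in \<rho>. \<iota> a y = 0" using linear_0[OF linear_\<iota>] by simp
qed

text \<open>A nonzero \<open>v\<close>, once normalised, competes in the supremum. The divisor
  \<open>d\<close> is kept apart from \<open>norm v\<close> because both parts of
  \<open>x - z\<close> will be divided by the length of \<open>x - z\<close>. For
  \<open>v = 0\<close> both sides are 0, even if the variation function is infinite.\<close>

lemma \<iota>_div_le_variation:
  assumes "\<iota> v \<in> A" "0 < d"
  shows "ennreal (\<bar>\<iota> v y\<bar> / d) \<le> ennreal (norm v / d) * ennreal_sqrt (variation_function \<rho> A y)"
proof (cases "v = 0")
  case True
  then show ?thesis using linear_0[OF linear_\<iota>] by simp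
next
  case False
  then have "(\<lambda>y. \<iota> v y / l2_norm \<rho> (\<iota> v)) \<in> unit_normalised \<rho> A"
    using assms unfolding unit_normalised_def by (intro image_eqI) (auto simp: AE_\<iota>_eq_0_iff)
  then have "ennreal (\<bar>\<iota> v y / l2_norm \<rho> (\<iota> v)\<bar>\<^sup>2) \<le> variation_function \<rho> A y"
    unfolding variation_function_def by (rule SUP_upper)
  then have "ennreal (\<bar>\<iota> v y\<bar> / norm v) \<le> ennreal_sqrt (variation_function \<rho> A y)"
    by (intro le_ennreal_sqrt) (simp_all add: norm_\<iota> power_divide)
  then have "ennreal (norm v / d) * ennreal (\<bar>\<iota> v y\<bar> / norm v)
      \<le> ennreal (norm v / d) * ennreal_sqrt (variation_function \<rho> A y)"
    by (rule mult_left_mono) simp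
  moreover have "ennreal (norm v / d) * ennreal (\<bar>\<iota> v y\<bar> / norm v) = ennreal (\<bar>\<iota> v y\<bar> / d)"
    using False assms(2) by (simp add: ennreal_mult[symmetric])
  ultimately show ?thesis by simp
qed

lemma \<iota>_in_function_span:
  assumes "n \<in> span (\<iota> -` N)"
  shows "\<iota> n \<in> function_span N"
proof -
  obtain F c where F: "finite F" "F \<subseteq> \<iota> -` N" "n = (\<Sum>a\<in>F. c a *\<^sub>R a)"
    using assms unfolding span_explicit by blast
  have inj: "inj_on \<iota> F" using inj_\<iota> by (rule inj_on_subset) simp
  have "\<iota> n y = (\<Sum>f\<in>\<iota> ` F. c (inv \<iota> f) * f y)" for y
  proof -
    have "\<iota> n y = (\<Sum>a\<in>F. c a * \<iota> a y)"
      unfolding F(3) using linear_sum[OF linear_\<iota>, of _ F y] linear_scale[OF linear_\<iota>] by simp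
    also have "\<dots> = (\<Sum>f\<in>\<iota> ` F. c (inv \<iota> f) * f y)"
      unfolding sum.reindex[OF inj] by (simp add: inv_f_f[OF inj_\<iota>])
    finally show ?thesis .
  qed
  then have "\<iota> n = (\<lambda>y. \<Sum>f\<in>\<iota> ` F. c (inv \<iota> f) * f y)" by blast
  then show ?thesis
    unfolding function_span_def using F(1,2)
    by (intro CollectI exI[of _ "\<iota> ` F"] exI[of _ "\<lambda>f. c (inv \<iota> f)"]) auto
qed

lemma l2_argmin_\<iota>:
  assumes "N \<subseteq> range \<iota>"
  shows "l2_argmin \<rho> N (\<iota> p) = \<iota> ` nearest_points (\<iota> -` N) p"
proof -
  have N: "(\<forall>f\<in>N. Q f) \<longleftrightarrow> (\<forall>z\<in>\<iota> -` N. Q (\<iota> z))" for Q using assms by blast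
  have "\<iota> q \<in> l2_argmin \<rho> N (\<iota> p) \<longleftrightarrow> q \<in> nearest_points (\<iota> -` N) p" for q
    using N[of "\<lambda>f. l2_norm \<rho> (\<lambda>y. \<iota> p y - \<iota> q y) \<le> l2_norm \<rho> (\<lambda>y. \<iota> p y - f y)"]
    unfolding l2_argmin_def is_arg_min_def nearest_points_def
    by (auto simp: \<iota>_diff norm_\<iota> dist_norm not_less)
  moreover have "l2_argmin \<rho> N (\<iota> p) \<subseteq> range \<iota>"
    using assms unfolding l2_argmin_def is_arg_min_def by blast
  ultimately show ?thesis by blast
qed

text \<open>The isometry maps the Euclidean ball into the ball of functions, so unique
  projectability is inherited by the model. The description by \<open>THE\<close> supplies the map
  \<open>P\<close> of the Euclidean lemmas.\<close>

lemma nearest_points_singleton: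
  assumes "N \<subseteq> range \<iota>" and ball: "V_ball \<rho> w (\<iota> x) s \<subseteq> proj_dom \<rho> w N" and p: "p \<in> ball x s"
  shows "nearest_points (\<iota> -` N) p = {THE q. q \<in> nearest_points (\<iota> -` N) p}"
proof -
  have "\<iota> p \<in> V_ball \<rho> w (\<iota> x) s"
    using p \<iota>_in_V by (simp add: V_ball_def \<iota>_diff norm_\<iota> dist_norm norm_minus_commute)
  then have "\<iota> p \<in> proj_dom \<rho> w N" using ball by (rule subsetD[rotated])
  then have "\<exists>!a. a \<in> \<iota> ` nearest_points (\<iota> -` N) p"
    unfolding proj_dom_def l2_argmin_\<iota>[OF assms(1)] mem_Collect_eq by (rule conjunct2)
  then have "\<exists>!q. q \<in> nearest_points (\<iota> -` N) p"
    using inj_\<iota> by (metis image_iff inj_eq)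
  then show ?thesis using theI'[of "\<lambda>q. q \<in> nearest_points (\<iota> -` N) p"] by blast
qed

lemma tangent_space_eq: "tangent_space \<iota> N (\<iota> x) = \<iota> ` velocity_space (\<iota> -` N) x"
  unfolding tangent_space_def using inj_\<iota> by (auto simp: inj_eq)

end

section \<open>The pointwise bound on the variation function\<close>

theorem theorem14:
  fixes \<rho> :: "'y measure"
    and w u uM :: "'y \<Rightarrow> real"
    and M N :: "('y \<Rightarrow> real) set"
    and \<iota> :: "'e::euclidean_space \<Rightarrow> 'y \<Rightarrow> real"
    and r :: real and R :: ennreal
  assumes "prob_space \<rho>"
    and "weight_function \<rho> w"
    and "M \<subseteq> V_space \<rho> w"
    and "u \<in> V_space \<rho> w"
    and "uM \<in> l2_argmin \<rho> M u"
    and "0 < r"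
    and "N \<subseteq> M \<inter> V_ball \<rho> w uM r"
    and "euclidean_subspace \<rho> w \<iota>"
    and "manifold_in \<iota> N"
    and "uM \<in> N"
    and "R = local_reach \<rho> w N uM"
    and "ennreal r \<le> R"
  shows "\<forall>y\<in>space \<rho>.
    variation_function \<rho> ((\<lambda>v y. uM y - v y) ` N) y
      \<le> (ennreal_sqrt (variation_function \<rho> (tangent_space \<iota> N uM) y)
          + ennreal r / (2 * R) * ennreal_sqrt (variation_function \<rho> (tangent_complement \<rho> \<iota> N uM) y))\<^sup>2"
proof
  fix y assume "y \<in> space \<rho>"
  interpret euclidean_function_space \<rho> w \<iota> by unfold_locales (rule assms(8))
  define S where "S = \<iota> -` N"
  have N: "N \<subseteq> range \<iota>" and S: "C1_submanifold S"
    using assms(9) by (simp_all add: manifold_in_def S_def)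
  obtain x where x: "uM = \<iota> x" "x \<in> S" using N assms(10) by (auto simp: S_def)
  let ?KT = "ennreal_sqrt (variation_function \<rho> (tangent_space \<iota> N uM) y)"
  let ?KN = "ennreal_sqrt (variation_function \<rho> (tangent_complement \<rho> \<iota> N uM) y)"
  let ?b = "ennreal r / (2 * R)"
  show "variation_function \<rho> ((\<lambda>v y. uM y - v y) ` N) y \<le> (?KT + ?b * ?KN)\<^sup>2"
  proof (rule variation_function_leI)
    fix a assume "a \<in> unit_normalised \<rho> ((\<lambda>v y. uM y - v y) ` N)"
    then obtain v where v: "v \<in> N" "\<not> (AE y in \<rho>. uM y - v y = 0)"
      "a = (\<lambda>y. (uM y - v y) / l2_norm \<rho> (\<lambda>y. uM y - v y))"
      unfolding unit_normalised_def by auto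
    obtain z where z: "v = \<iota> z" "z \<in> S" using N v(1) by (auto simp: S_def)
    define d where "d = norm (x - z)"
    have uv: "(\<lambda>y. uM y - v y) = \<iota> (x - z)" unfolding x z by (rule \<iota>_diff)
    have d: "d > 0"
      using v(2) AE_\<iota>_eq_0_iff[of "x - z"] unfolding uv[symmetric] by (auto simp: d_def)
    have "\<iota> z \<in> V_ball \<rho> w (\<iota> x) r" using assms(7) v(1) x z by auto
    then have dr: "d < r" by (simp add: V_ball_def \<iota>_diff norm_\<iota> d_def norm_minus_commute)
    obtain t n where t: "t \<in> velocity_space S x" "x - z = t + n" "norm t \<le> norm (x - z)"
      and n: "\<And>t'. t' \<in> velocity_space S x \<Longrightarrow> n \<bullet> t' = 0" "n \<in> span S"
      and reach: "\<And>s P. \<lbrakk>0 \<le> s; \<And>p. p \<in> ball x s \<Longrightarrow> nearest_points S p = {P p}\<rbrakk>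
        \<Longrightarrow> 2 * s * norm n \<le> (norm (x - z))\<^sup>2"
      using C1_submanifold_reach_decomposition[OF S x(2) z(2)] by blast
    \<comment> \<open>Federer's inequality and \<open>d < r\<close> give
      \<open>norm n / d \<le> d / (2 * R) \<le> r / (2 * R)\<close>. An infinite reach is possible
      only for \<open>n = 0\<close>, where the left side is 0.\<close>
    have nb: "ennreal (norm n / d) \<le> ?b"
    proof (cases "n = 0")
      case False
      have "R \<le> ennreal (d\<^sup>2 / (2 * norm n))"
        unfolding assms(11) local_reach_def
      proof (rule SUP_least)
        fix s assume s: "s \<in> {s. 0 \<le> s \<and> V_ball \<rho> w uM s \<subseteq> proj_dom \<rho> w N}"
        then have ball: "V_ball \<rho> w (\<iota> x) s \<subseteq> proj_dom \<rho> w N" and "0 \<le> s"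
          using x(1) by auto
        have "2 * s * norm n \<le> (norm (x - z))\<^sup>2"
          by (rule reach[OF \<open>0 \<le> s\<close>]) (use nearest_points_singleton[OF N ball] in \<open>simp add: S_def\<close>)
        then have "s \<le> d\<^sup>2 / (2 * norm n)"
          using False by (simp add: pos_le_divide_eq d_def algebra_simps)
        then show "ennreal s \<le> ennreal (d\<^sup>2 / (2 * norm n))" by (rule ennreal_leI)
      qed
      \<comment> \<open>For \<open>n \<noteq> 0\<close> the bound just shown makes \<open>R\<close>
        finite, so the computation continues in the reals; \<open>r \<le> R\<close> then makes it
        positive.\<close>
      then obtain R' where R': "R = ennreal R'" "0 \<le> R'" "R' \<le> d\<^sup>2 / (2 * norm n)"
        by (cases R) (auto simp: top_unique)
      have "r \<le> R'" using assms(6,12) R' by simp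
      then have pos: "0 < R'" using assms(6) by simp
      have "norm n * (2 * R') \<le> d * d"
        using R'(3) False by (simp add: pos_le_divide_eq power2_eq_square algebra_simps)
      also have "\<dots> \<le> r * d" using dr d by simp
      finally have "norm n / d \<le> r / (2 * R')" using pos d by (simp add: field_simps)
      then have "ennreal (norm n / d) \<le> ennreal (r / (2 * R'))" by (rule ennreal_leI)
      also have "\<dots> = ennreal r / ennreal (2 * R')"
        using pos assms(6) by (simp add: divide_ennreal)
      also have "ennreal (2 * R') = 2 * R" using pos R'(1) by (simp add: ennreal_mult)
      finally show ?thesis .
    qed simp
    have tT: "\<iota> t \<in> tangent_space \<iota> N uM"
      using t(1) unfolding x tangent_space_eq S_def by blast
    have nN: "\<iota> n \<in> tangent_complement \<rho> \<iota> N uM"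
      using n \<iota>_in_function_span[of n N] unfolding tangent_complement_def x tangent_space_eq S_def
      by (auto simp: inner_\<iota>)
    \<comment> \<open>The two parts are evaluated at \<open>y\<close> separately and each is bounded
      by its own variation function, with factors \<open>norm t / d \<le> 1\<close> and
      \<open>norm n / d \<le> ?b\<close>.\<close>
    have "ennreal (\<bar>\<iota> (x - z) y\<bar> / d) \<le> ennreal (\<bar>\<iota> t y\<bar> / d + \<bar>\<iota> n y\<bar> / d)"
      unfolding t(2) \<iota>_add using d
      by (intro ennreal_leI) (simp add: add_divide_distrib[symmetric] divide_right_mono abs_triangle_ineq)
    also have "\<dots> = ennreal (\<bar>\<iota> t y\<bar> / d) + ennreal (\<bar>\<iota> n y\<bar> / d)"
      using d by (intro ennreal_plus) auto
    also have "\<dots> \<le> ennreal (norm t / d) * ?KT + ennreal (norm n / d) * ?KN"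
      by (intro add_mono \<iota>_div_le_variation tT nN d)
    also have "\<dots> \<le> 1 * ?KT + ?b * ?KN"
      using t(3) d nb by (intro add_mono mult_right_mono) (simp_all add: d_def)
    finally have le: "ennreal (\<bar>\<iota> (x - z) y\<bar> / d) \<le> ?KT + ?b * ?KN" by simp
    have "a y = \<iota> (x - z) y / d"
      using fun_cong[OF uv, of y] unfolding v(3) uv norm_\<iota> d_def by simp
    then have "ennreal (\<bar>a y\<bar>\<^sup>2) = (ennreal (\<bar>\<iota> (x - z) y\<bar> / d))\<^sup>2"
      using d by (simp add: ennreal_power)
    also have "\<dots> \<le> (?KT + ?b * ?KN)\<^sup>2" using le by (intro power_mono) auto
    finally show "ennreal (\<bar>a y\<bar>\<^sup>2) \<le> (?KT + ?b * ?KN)\<^sup>2" .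
  qed
qed

end
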